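(* Let $d$ be a positive integer, let $G=(V,E)$ be a graph, and let $u,v\in V$. If $\{u,v\}$ is $(d+1)$-linked in $G$, then $\{u,v\}$ is $d$-stress-linked in $G$.
   Context: All graphs are finite and simple. For a positive integer $k$, a framework in $\mathbb{R}^k$ is $(G,p)$ with $p:V\to\mathbb{R}^k$, generic if all coordinates are algebraically independent over $\mathbb{Q}$. $\mathcal{R}_k(G)$ is the row matroid of the rigidity matrix $R(G,p)$ for generic $p$ in $\mathbb{R}^k$ (row of edge $xy$ has $p(x)-p(y)$ in the columns of $x$, $p(y)-p(x)$ in those of $y$, zeros elsewhere), with rank $r_k(G)$. A pair $\{u,v\}$ is $k$-linked in $G$ if $r_k(G+uv)=r_k(G)$. A stress of $(G,p)$ is $\omega\in\mathbb{R}^E$ with $\sum_{x:xy\in E}\omega(xy)(p(x)-p(y))=0$ for all $y\in V$; $S(G,p)$ is the stress space. $\{u,v\}$ is $d$-stress-linked in $G$ if it is $d$-linked in $G$ and for every generic $(G,p)$ in $\mathbb{R}^d$ and every $(G,q)$ in $\mathbb{R}^d$ with $S(G,p)\subseteq S(G,q)$ we have $S(G+uv,p)\subseteq S(G+uv,q)$ (with $G+uv=G$ if $uv\in E$). *)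

theory Defs
  imports Complex_Main "HOL-Library.Poly_Mapping" "HOL-Library.Function_Algebras"
begin

text \<open>
  A graph is given by its vertex set \<open>V\<close> and its set \<open>E\<close> of edges, an edge being the
  two-element set of its endpoints.
\<close>

definition simple_graph :: "'v set \<Rightarrow> 'v set set \<Rightarrow> bool" where
  "simple_graph V E \<longleftrightarrow> finite V \<and> (\<forall>e\<in>E. \<exists>x\<in>V. \<exists>y\<in>V. x \<noteq> y \<and> e = {x, y})"

definition add_edge :: "'v \<Rightarrow> 'v \<Rightarrow> 'v set set \<Rightarrow> 'v set set" where
  "add_edge u v E = insert {u, v} E"

text \<open>
  A polynomial over the rationals in variables indexed by \<open>'i\<close> is a finitely supported map
  from monomials to coefficients, a monomial being a finitely supported map from variables
  to exponents.
\<close>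

definition poly_value :: "(('i \<Rightarrow>\<^sub>0 nat) \<Rightarrow>\<^sub>0 rat) \<Rightarrow> ('i \<Rightarrow> real) \<Rightarrow> real" where
  "poly_value P x =
     (\<Sum>m\<in>Poly_Mapping.keys P.
        of_rat (Poly_Mapping.lookup P m)
        * (\<Prod>i\<in>Poly_Mapping.keys m. x i ^ Poly_Mapping.lookup m i))"

definition alg_independent_rat :: "'i set \<Rightarrow> ('i \<Rightarrow> real) \<Rightarrow> bool" where
  "alg_independent_rat I x \<longleftrightarrow>
     (\<forall>P. (\<forall>m\<in>Poly_Mapping.keys P. Poly_Mapping.keys m \<subseteq> I) \<longrightarrow> poly_value P x = 0 \<longrightarrow> P = 0)"

text \<open>
  A placement of the vertices in \<open>\<real>\<^sup>k\<close> is a function \<open>p :: 'v \<Rightarrow> nat \<Rightarrow> real\<close>, where \<open>p x i\<close>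
  for \<open>i < k\<close> is the \<open>i\<close>-th coordinate of the point of \<open>x\<close>. Its values at \<open>x \<notin> V\<close> or \<open>i \<ge> k\<close>
  are never used.
\<close>

definition generic :: "nat \<Rightarrow> 'v set \<Rightarrow> ('v \<Rightarrow> nat \<Rightarrow> real) \<Rightarrow> bool" where
  "generic k V p \<longleftrightarrow> alg_independent_rat (V \<times> {..<k}) (\<lambda>(x, i). p x i)"

text \<open>
  The row of the edge \<open>e\<close>, as a function of the column \<open>(z, i)\<close>. For \<open>e = {x, y}\<close> with
  \<open>x \<noteq> y\<close> the sum has a single summand, which belongs to the endpoint other than \<open>z\<close>.
  For \<open>x = y\<close> the row is zero.
\<close>

definition rigidity_row ::
    "nat \<Rightarrow> ('v \<Rightarrow> nat \<Rightarrow> real) \<Rightarrow> 'v set \<Rightarrow> 'v \<times> nat \<Rightarrow> real" where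
  "rigidity_row k p e =
     (\<lambda>(z, i). if z \<in> e \<and> i < k then (\<Sum>w\<in>e - {z}. p z i - p w i) else 0)"

interpretation real_fun: vector_space "\<lambda>(c::real) (f :: 'c \<Rightarrow> real) x. c * f x"
  by unfold_locales (auto simp: fun_eq_iff algebra_simps)

definition rigidity_matrix_rank ::
    "nat \<Rightarrow> 'v set set \<Rightarrow> ('v \<Rightarrow> nat \<Rightarrow> real) \<Rightarrow> nat" where
  "rigidity_matrix_rank k E p = real_fun.dim (rigidity_row k p ` E)"

text \<open>
  The rank of the generic rigidity matroid: the value that the rank of the rigidity matrix
  takes at every generic placement of the vertices.
\<close>

definition rigidity_rank :: "nat \<Rightarrow> 'v set \<Rightarrow> 'v set set \<Rightarrow> nat" where
  "rigidity_rank k V E = (THE r. \<forall>p. generic k V p \<longrightarrow> rigidity_matrix_rank k E p = r)"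

definition linked :: "nat \<Rightarrow> 'v set \<Rightarrow> 'v set set \<Rightarrow> 'v \<Rightarrow> 'v \<Rightarrow> bool" where
  "linked k V E u v \<longleftrightarrow> rigidity_rank k V (add_edge u v E) = rigidity_rank k V E"

text \<open>The space \<open>\<real>\<^sup>E\<close> is represented by the functions on sets of vertices that vanish off \<open>E\<close>.\<close>

definition stress_space ::
    "nat \<Rightarrow> 'v set \<Rightarrow> 'v set set \<Rightarrow> ('v \<Rightarrow> nat \<Rightarrow> real) \<Rightarrow> ('v set \<Rightarrow> real) set" where
  "stress_space k V E p =
     {\<omega>. (\<forall>e. e \<notin> E \<longrightarrow> \<omega> e = 0) \<and>
         (\<forall>y\<in>V. \<forall>i<k. (\<Sum>x | x \<in> V \<and> {x, y} \<in> E. \<omega> {x, y} * (p x i - p y i)) = 0)}"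

definition stress_linked :: "nat \<Rightarrow> 'v set \<Rightarrow> 'v set set \<Rightarrow> 'v \<Rightarrow> 'v \<Rightarrow> bool" where
  "stress_linked d V E u v \<longleftrightarrow>
     linked d V E u v \<and>
     (\<forall>p q. generic d V p \<longrightarrow> stress_space d V E p \<subseteq> stress_space d V E q \<longrightarrow>
        stress_space d V (add_edge u v E) p \<subseteq> stress_space d V (add_edge u v E) q)"

end

theory Submission
  imports Defs "HOL-Analysis.Continuum_Not_Denumerable"
begin

text \<open>
  Write \<open>L\<^sub>\<omega>\<close> for the symmetric weighted Laplacian of \<open>\<omega>\<close>, so that \<open>\<omega>\<close> is a stress of \<open>p\<close> iff
  \<open>L\<^sub>\<omega>\<close> kills every coordinate of \<open>p\<close>. Lift \<open>p\<close> to a generic placement \<open>(p, g)\<close> in one more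
  dimension. Since \<open>uv\<close> is linked there, \<open>(p, g)\<close> has a stress \<open>\<omega>'\<close> of \<open>G + uv\<close> with \<open>\<omega>'(uv) = -1\<close>.
  If \<open>\<omega>\<close> is a stress of \<open>(G + uv, p)\<close>, then \<open>\<sigma> = \<omega> + \<omega>(uv) \<omega>'\<close> is a stress of \<open>(G, p)\<close>, hence it
  kills each coordinate \<open>h\<close> of \<open>q\<close>. By symmetry of \<open>L\<^sub>\<omega>\<^sub>'\<close> and \<open>L\<^sub>\<omega>\<^sub>' g = 0\<close> we get
  \<open>\<langle>g, L\<^sub>\<omega> h\<rangle> = \<langle>g, L\<^sub>\<sigma> h\<rangle> - \<omega>(uv) \<langle>L\<^sub>\<omega>\<^sub>' g, h\<rangle> = 0\<close>. As \<open>\<omega>\<close> and \<open>h\<close> do not depend on \<open>g\<close>, comparing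
  two generic lifts that differ at a single vertex \<open>w\<close> gives \<open>(L\<^sub>\<omega> h)(w) = 0\<close>.
\<close>

subsection \<open>Values of rational polynomials\<close>

definition monom_value :: "('i \<Rightarrow>\<^sub>0 nat) \<Rightarrow> ('i \<Rightarrow> real) \<Rightarrow> real" where
  "monom_value m x = (\<Prod>i\<in>Poly_Mapping.keys m. x i ^ Poly_Mapping.lookup m i)"

definition poly_in :: "'i set \<Rightarrow> (('i \<Rightarrow>\<^sub>0 nat) \<Rightarrow>\<^sub>0 rat) \<Rightarrow> bool" where
  "poly_in I P \<longleftrightarrow> (\<forall>m\<in>Poly_Mapping.keys P. Poly_Mapping.keys m \<subseteq> I)"

lemma monom_value_superset:
  assumes "finite K" "Poly_Mapping.keys m \<subseteq> K"
  shows "monom_value m x = (\<Prod>i\<in>K. x i ^ Poly_Mapping.lookup m i)"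
  unfolding monom_value_def using assms
  by (intro prod.mono_neutral_left) (auto simp: in_keys_iff)

lemma monom_value_add: "monom_value (m + n) x = monom_value m x * monom_value n x"
proof -
  let ?K = "Poly_Mapping.keys m \<union> Poly_Mapping.keys n"
  have "Poly_Mapping.keys (m + n) \<subseteq> ?K" by (rule keys_add)
  then show ?thesis
    by (simp add: monom_value_superset[of ?K] lookup_add power_add prod.distrib)
qed

lemma poly_value_superset:
  assumes "finite K" "Poly_Mapping.keys P \<subseteq> K"
  shows "poly_value P x = (\<Sum>m\<in>K. of_rat (Poly_Mapping.lookup P m) * monom_value m x)"
  unfolding poly_value_def monom_value_def using assms
  by (intro sum.mono_neutral_left) (auto simp: in_keys_iff)

lemma poly_value_zero [simp]: "poly_value 0 x = 0"
  by (simp add: poly_value_def)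

lemma poly_value_add: "poly_value (P + Q) x = poly_value P x + poly_value Q x"
proof -
  let ?K = "Poly_Mapping.keys P \<union> Poly_Mapping.keys Q"
  have "Poly_Mapping.keys (P + Q) \<subseteq> ?K" by (rule keys_add)
  then show ?thesis
    by (simp add: poly_value_superset[of ?K] lookup_add of_rat_add distrib_right sum.distrib)
qed

lemma poly_value_diff: "poly_value (P - Q) x = poly_value P x - poly_value Q x"
  using poly_value_add[of "P - Q" Q x] by simp

lemma poly_value_sum: "poly_value (\<Sum>a\<in>A. f a) x = (\<Sum>a\<in>A. poly_value (f a) x)"
  by (induction A rule: infinite_finite_induct) (auto simp: poly_value_add)

lemma poly_value_single: "poly_value (Poly_Mapping.single m c) x = of_rat c * monom_value m x"
  by (subst poly_value_superset[of "{m}"]) auto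

lemma poly_mapping_eq_sum_single:
  "P = (\<Sum>m\<in>Poly_Mapping.keys P. Poly_Mapping.single m (Poly_Mapping.lookup P m))"
  by (rule poly_mapping_eqI)
    (auto simp: lookup_sum lookup_single when_def in_keys_iff)

lemma poly_value_mult: "poly_value (P * Q) x = poly_value P x * poly_value Q x"
proof -
  define K L where "K = Poly_Mapping.keys P" and "L = Poly_Mapping.keys Q"
  have "P * Q = (\<Sum>m\<in>K. Poly_Mapping.single m (Poly_Mapping.lookup P m)) *
      (\<Sum>n\<in>L. Poly_Mapping.single n (Poly_Mapping.lookup Q n))"
    unfolding K_def L_def by (simp flip: poly_mapping_eq_sum_single)
  also have "\<dots> = (\<Sum>m\<in>K. \<Sum>n\<in>L.
      Poly_Mapping.single (m + n) (Poly_Mapping.lookup P m * Poly_Mapping.lookup Q n))"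
    by (simp only: sum_product mult_single)
  finally have "poly_value (P * Q) x = (\<Sum>m\<in>K. \<Sum>n\<in>L.
      (of_rat (Poly_Mapping.lookup P m) * monom_value m x) *
      (of_rat (Poly_Mapping.lookup Q n) * monom_value n x))"
    by (simp add: poly_value_sum poly_value_single of_rat_mult monom_value_add mult_ac)
  also have "\<dots> = poly_value P x * poly_value Q x"
    by (simp only: sum_product[symmetric] K_def L_def poly_value_superset[OF finite_keys order_refl])
  finally show ?thesis .
qed

lemma poly_in_diff: "poly_in I P \<Longrightarrow> poly_in I Q \<Longrightarrow> poly_in I (P - Q)"
  using keys_diff[of P Q] unfolding poly_in_def by blast

lemma poly_in_mult:
  assumes "poly_in I P" "poly_in I Q"
  shows "poly_in I (P * Q)"
  unfolding poly_in_def
proof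
  fix k assume "k \<in> Poly_Mapping.keys (P * Q)"
  then obtain m n where "m \<in> Poly_Mapping.keys P" "n \<in> Poly_Mapping.keys Q" "k = m + n"
    using keys_mult[of P Q] by blast
  with assms show "Poly_Mapping.keys k \<subseteq> I"
    using keys_add[of m n] unfolding poly_in_def by blast
qed

lemma alg_independent_rat_iff:
  "alg_independent_rat I x \<longleftrightarrow> (\<forall>P. poly_in I P \<longrightarrow> poly_value P x = 0 \<longrightarrow> P = 0)"
  unfolding alg_independent_rat_def poly_in_def ..

lemma alg_independent_rat_subset:
  "alg_independent_rat J x \<Longrightarrow> I \<subseteq> J \<Longrightarrow> alg_independent_rat I x"
  unfolding alg_independent_rat_iff poly_in_def by blast

lemma poly_value_cong:
  assumes "poly_in I P" "\<And>i. i \<in> I \<Longrightarrow> x i = y i"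
  shows "poly_value P x = poly_value P y"
  unfolding poly_value_def using assms
  by (intro sum.cong prod.cong arg_cong2[where f = "(*)"] arg_cong2[where f = "(^)"] refl)
    (auto simp: poly_in_def)

lemma alg_independent_rat_cong:
  assumes "\<And>i. i \<in> I \<Longrightarrow> x i = y i"
  shows "alg_independent_rat I x \<longleftrightarrow> alg_independent_rat I y"
proof -
  have "poly_value P x = poly_value P y" if "poly_in I P" for P
    using that assms by (rule poly_value_cong)
  then show ?thesis unfolding alg_independent_rat_iff by simp
qed

text \<open>Without variables \<open>0\<close> is the only monomial, so \<open>P\<close> is a
  rational constant. This starts the construction of generic placements.\<close>

lemma alg_independent_rat_empty: "alg_independent_rat {} x"
  unfolding alg_independent_rat_iff
proof (intro allI impI)
  fix P :: "('a \<Rightarrow>\<^sub>0 nat) \<Rightarrow>\<^sub>0 rat"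
  assume "poly_in {} P" "poly_value P x = 0"
  then have keys: "Poly_Mapping.keys P \<subseteq> {0}"
    by (auto simp: poly_in_def)
  with \<open>poly_value P x = 0\<close> have "Poly_Mapping.lookup P 0 = 0"
    by (simp add: poly_value_superset[of "{0}"] monom_value_def)
  with keys show "P = 0"
    by (auto simp: in_keys_iff intro!: poly_mapping_eqI)
qed

subsection \<open>Extending algebraically independent families\<close>

text \<open>A finitely supported map is determined by its finite graph over the support, and a
  countable set has countably many finite subsets.\<close>

lemma countable_poly_mappings:
  assumes "countable A"
  shows "countable {P :: 'a \<Rightarrow>\<^sub>0 'b::{zero,countable}. Poly_Mapping.keys P \<subseteq> A}"
proof (rule countable_image_inj_on)
  let ?graph = "\<lambda>P. (\<lambda>k. (k, Poly_Mapping.lookup P k)) ` Poly_Mapping.keys (P :: 'a \<Rightarrow>\<^sub>0 'b)"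
  have "?graph ` {P. Poly_Mapping.keys P \<subseteq> A} \<subseteq> {T. T \<subseteq> A \<times> UNIV \<and> finite T}"
    by auto
  moreover have "countable {T. T \<subseteq> A \<times> (UNIV :: 'b set) \<and> finite T}"
    using assms countable_Collect_finite_subset[of "A \<times> (UNIV :: 'b set)"]
    by (simp add: conj_commute)
  ultimately show "countable (?graph ` {P. Poly_Mapping.keys P \<subseteq> A})"
    by (rule countable_subset)
  show "inj_on ?graph {P. Poly_Mapping.keys P \<subseteq> A}"
  proof (rule inj_onI, rule poly_mapping_eqI)
    fix P Q k assume eq: "?graph P = ?graph Q"
    have *: "(k, c) \<in> ?graph R \<longleftrightarrow> c = Poly_Mapping.lookup R k \<and> c \<noteq> 0" for R c
      by (auto simp: in_keys_iff)
    show "Poly_Mapping.lookup P k = Poly_Mapping.lookup Q k"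
      using *[of "Poly_Mapping.lookup P k" P] *[of "Poly_Mapping.lookup P k" Q]
        *[of "Poly_Mapping.lookup Q k" P] *[of "Poly_Mapping.lookup Q k" Q] unfolding eq by argo
  qed
qed

lemma countable_poly_in:
  assumes "countable I"
  shows "countable {P. poly_in I P}"
  unfolding poly_in_def
  \<comment> \<open>The inner instance counts monomials, the outer one polynomials.\<close>
  using countable_poly_mappings[OF countable_poly_mappings[OF assms]]
  by (rule countable_subset[rotated]) auto

text \<open>Reads \<open>P\<close> as a univariate polynomial in the variable \<open>i\<close>; this
  is the coefficient of its \<open>n\<close>-th power.\<close>

definition coeff_wrt ::
    "'i \<Rightarrow> (('i \<Rightarrow>\<^sub>0 nat) \<Rightarrow>\<^sub>0 rat) \<Rightarrow> nat \<Rightarrow> (('i \<Rightarrow>\<^sub>0 nat) \<Rightarrow>\<^sub>0 rat)" where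
  "coeff_wrt i P n =
     (\<Sum>m\<in>{m\<in>Poly_Mapping.keys P. Poly_Mapping.lookup m i = n}.
        Poly_Mapping.single (m - Poly_Mapping.single i n) (Poly_Mapping.lookup P m))"

text \<open>Subtraction of exponents is truncated; the hypothesis makes it exact at
  \<open>i\<close>.\<close>

lemma monom_split:
  fixes m :: "'i \<Rightarrow>\<^sub>0 nat"
  assumes "Poly_Mapping.lookup m i = n"
  shows "m - Poly_Mapping.single i n + Poly_Mapping.single i n = m"
  using assms by (intro poly_mapping_eqI) (auto simp: lookup_add lookup_minus lookup_single when_def)

lemma keys_coeff_wrt:
  assumes "k \<in> Poly_Mapping.keys (coeff_wrt i P n)"
  shows "k + Poly_Mapping.single i n \<in> Poly_Mapping.keys P" "Poly_Mapping.lookup k i = 0"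
proof -
  obtain m where m: "m \<in> Poly_Mapping.keys P" "Poly_Mapping.lookup m i = n"
    and "Poly_Mapping.lookup (Poly_Mapping.single (m - Poly_Mapping.single i n)
          (Poly_Mapping.lookup P m)) k \<noteq> 0"
    using assms unfolding coeff_wrt_def in_keys_iff lookup_sum
    by (auto elim!: sum.not_neutral_contains_not_neutral)
  then have k: "k = m - Poly_Mapping.single i n"
    by (auto simp: lookup_single when_def split: if_splits)
  show "k + Poly_Mapping.single i n \<in> Poly_Mapping.keys P"
    using m k by (simp add: monom_split)
  show "Poly_Mapping.lookup k i = 0"
    using m k by (simp add: lookup_minus)
qed

lemma poly_in_coeff_wrt:
  assumes "poly_in (insert i I) P"
  shows "poly_in I (coeff_wrt i P n)"
  unfolding poly_in_def
proof (intro ballI subsetI)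
  fix k j assume k: "k \<in> Poly_Mapping.keys (coeff_wrt i P n)" and j: "j \<in> Poly_Mapping.keys k"
  have "j \<noteq> i" using keys_coeff_wrt(2)[OF k] j by (auto simp: in_keys_iff)
  moreover have "j \<in> Poly_Mapping.keys (k + Poly_Mapping.single i n)"
    using j by (simp add: in_keys_iff lookup_add)
  ultimately show "j \<in> I"
    using keys_coeff_wrt(1)[OF k] assms unfolding poly_in_def by blast
qed

text \<open>Removing the power of \<open>i\<close> is injective on monomials of degree
  \<open>n\<close> in \<open>i\<close>, so no coefficients merge. Hence a nonzero polynomial has a
  nonzero coefficient.\<close>

lemma lookup_coeff_wrt:
  assumes "m \<in> Poly_Mapping.keys P" "Poly_Mapping.lookup m i = n"
  shows "Poly_Mapping.lookup (coeff_wrt i P n) (m - Poly_Mapping.single i n) = Poly_Mapping.lookup P m"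
proof -
  have inj: "m' = m" if "Poly_Mapping.lookup m' i = n"
    "m' - Poly_Mapping.single i n = m - Poly_Mapping.single i n" for m'
    using that assms(2) by (metis monom_split)
  have "Poly_Mapping.lookup (coeff_wrt i P n) (m - Poly_Mapping.single i n) =
      (\<Sum>m'\<in>{m\<in>Poly_Mapping.keys P. Poly_Mapping.lookup m i = n}.
        if m' = m then Poly_Mapping.lookup P m else 0)"
    unfolding coeff_wrt_def lookup_sum
    by (intro sum.cong refl) (use inj in \<open>auto simp: lookup_single when_def\<close>)
  also have "\<dots> = Poly_Mapping.lookup P m"
    using assms by simp
  finally show ?thesis .
qed

lemma poly_value_coeff_wrt:
  assumes "poly_in (insert i I) P" "i \<notin> I" "finite N"
    "\<And>m. m \<in> Poly_Mapping.keys P \<Longrightarrow> Poly_Mapping.lookup m i \<in> N"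
  shows "poly_value P (x(i := a)) = (\<Sum>n\<in>N. poly_value (coeff_wrt i P n) x * a ^ n)"
proof -
  have monom: "monom_value m (x(i := a)) =
      monom_value (m - Poly_Mapping.single i n) x * a ^ n"
    if "Poly_Mapping.lookup m i = n" for m n
  proof -
    let ?m = "m - Poly_Mapping.single i n"
    have "i \<notin> Poly_Mapping.keys ?m"
      using that by (simp add: in_keys_iff lookup_minus)
    then have "monom_value ?m (x(i := a)) = monom_value ?m x"
      unfolding monom_value_def by (auto intro!: prod.cong)
    moreover have "monom_value (Poly_Mapping.single i n) (x(i := a)) = a ^ n"
      by (simp add: monom_value_superset[of "{i}"])
    ultimately show ?thesis
      using monom_value_add[of ?m "Poly_Mapping.single i n" "x(i := a)"] monom_split[OF that]
      by simp
  qed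
  have "poly_value P (x(i := a)) =
      (\<Sum>m\<in>Poly_Mapping.keys P. of_rat (Poly_Mapping.lookup P m) * monom_value m (x(i := a)))"
    by (rule poly_value_superset) auto
  also have "\<dots> = (\<Sum>n\<in>N. \<Sum>m\<in>{m\<in>Poly_Mapping.keys P. Poly_Mapping.lookup m i = n}.
      of_rat (Poly_Mapping.lookup P m) * monom_value m (x(i := a)))"
    using assms(3,4) by (intro sum.group[symmetric]) auto
  also have "\<dots> = (\<Sum>n\<in>N. poly_value (coeff_wrt i P n) x * a ^ n)"
    by (auto simp: coeff_wrt_def poly_value_sum poly_value_single sum_distrib_right monom mult.assoc
        intro!: sum.cong)
  finally show ?thesis .
qed

text \<open>Some coefficient of \<open>P\<close> in the variable \<open>i\<close> is a nonzero
  polynomial over \<open>I\<close>, hence nonzero at \<open>x\<close>. What remains is a nonzero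
  univariate polynomial in \<open>a\<close>.\<close>

lemma finite_roots_poly_value:
  assumes x: "alg_independent_rat I x" and "i \<notin> I" and P: "poly_in (insert i I) P" "P \<noteq> 0"
  shows "finite {a. poly_value P (x(i := a)) = 0}"
proof -
  obtain m where m: "m \<in> Poly_Mapping.keys P"
    using P(2) by (metis keys_eq_empty ex_in_conv)
  define N where "N = Max ((\<lambda>m. Poly_Mapping.lookup m i) ` Poly_Mapping.keys P)"
  have N: "Poly_Mapping.lookup k i \<in> {..N}" if "k \<in> Poly_Mapping.keys P" for k
    using that by (simp add: N_def)
  define n where "n = Poly_Mapping.lookup m i"
  have "coeff_wrt i P n \<noteq> 0"
    using lookup_coeff_wrt[OF m n_def[symmetric]] m by (auto simp: in_keys_iff)
  then have "poly_value (coeff_wrt i P n) x \<noteq> 0"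
    using x poly_in_coeff_wrt[OF P(1)] unfolding alg_independent_rat_iff by blast
  then have "finite {a. (\<Sum>n\<le>N. poly_value (coeff_wrt i P n) x * a ^ n) = 0}"
    using polyfun_finite_roots[of "\<lambda>n. poly_value (coeff_wrt i P n) x" N] N[OF m]
    by (auto simp: n_def)
  then show ?thesis
    using poly_value_coeff_wrt[OF P(1) \<open>i \<notin> I\<close> finite_atMost N] by simp
qed

text \<open>There are countably many polynomials, and each nonzero one excludes only finitely many
  values of \<open>a\<close>.\<close>

lemma countable_dependent_extensions:
  assumes "alg_independent_rat I x" "i \<notin> I" "finite I"
  shows "countable {a. \<not> alg_independent_rat (insert i I) (x(i := a))}"
proof -
  have "{a. \<not> alg_independent_rat (insert i I) (x(i := a))} =
      (\<Union>P\<in>{P. poly_in (insert i I) P} - {0}. {a. poly_value P (x(i := a)) = 0})"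
    unfolding alg_independent_rat_iff by blast
  moreover have "countable {P. poly_in (insert i I) P}"
    using assms(3) by (intro countable_poly_in countable_finite) auto
  ultimately show ?thesis
    using finite_roots_poly_value[OF assms(1,2)]
    by (simp only:) (rule countable_UN[OF countable_Diff], auto intro: countable_finite)
qed

text \<open>The reals are uncountable. The set \<open>A\<close> allows asking for a value different
  from one chosen before.\<close>

lemma alg_independent_rat_extend_notin:
  assumes "alg_independent_rat I x" "i \<notin> I" "finite I" "countable A"
  obtains a where "a \<notin> A" "alg_independent_rat (insert i I) (x(i := a))"
proof -
  have "countable (A \<union> {a. \<not> alg_independent_rat (insert i I) (x(i := a))})"
    using countable_dependent_extensions[OF assms(1-3)] assms(4) by (rule countable_Un[rotated])
  then have "A \<union> {a. \<not> alg_independent_rat (insert i I) (x(i := a))} \<noteq> UNIV"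
    using uncountable_UNIV_real by force
  then show ?thesis using that by blast
qed

lemma alg_independent_rat_extend:
  assumes "finite J" "finite I" "alg_independent_rat I x"
  shows "\<exists>y. (\<forall>i\<in>I. y i = x i) \<and> alg_independent_rat (I \<union> J) y"
  using assms(1)
proof (induction J rule: finite_induct)
  case empty
  then show ?case using assms(3) by auto
next
  case (insert j J)
  then obtain y where y: "\<forall>i\<in>I. y i = x i" "alg_independent_rat (I \<union> J) y" by blast
  show ?case
  proof (cases "j \<in> I")
    case True
    then show ?thesis using y by (auto simp: insert_absorb)
  next
    case False
    then obtain a where "alg_independent_rat (insert j (I \<union> J)) (y(j := a))"
      using alg_independent_rat_extend_notin[OF y(2), of j "{}"] insert assms(2) by auto
    then show ?thesis
      using y(1) False by (intro exI[of _ "y(j := a)"]) (auto simp del: fun_upd_apply, auto)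
  qed
qed

subsection \<open>Generic ranks\<close>

text \<open>A basis inside the finite set \<open>S\<close> is finite, so dimensions are honest
  cardinalities even if the whole space is infinite-dimensional.\<close>

lemma (in vector_space) dim_insert_finite:
  assumes "finite S"
  shows "dim (insert a S) = (if a \<in> span S then dim S else Suc (dim S))"
proof (cases "a \<in> span S")
  case True
  then show ?thesis by (metis dim_span span_redundant)
next
  case False
  obtain B where B: "B \<subseteq> S" "independent B" "S \<subseteq> span B" "card B = dim S"
    by (rule basis_exists)
  then have span: "span B = span S"
    by (metis span_eq span_superset subset_trans)
  with False have "a \<notin> span B" by simp
  then have "independent (insert a B)" "a \<notin> B"
    using independent_insertI[OF _ B(2)] by (auto intro: span_base)
  moreover have "span (insert a B) = span (insert a S)"
    using span by (simp add: span_insert)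
  ultimately have "dim (insert a S) = card (insert a B)"
    by (intro dim_eq_card)
  also have "\<dots> = Suc (dim S)"
    using B assms \<open>a \<notin> B\<close> by (auto dest: finite_subset)
  finally show ?thesis using False by simp
qed

section \<open>Fraction-free Gaussian elimination\<close>

lemma in_span_eq_zero:
  assumes "f \<in> real_fun.span B" "\<And>g. g \<in> B \<Longrightarrow> g c = 0"
  shows "f c = 0"
  using assms(1)
proof (rule real_fun.span_induct)
  show "real_fun.subspace {f. f c = 0}"
    by (auto simp: real_fun.subspace_def)
qed (use assms(2) in auto)

text \<open>Multiplying by the pivot instead of dividing by it keeps polynomial entries polynomial.
  Column \<open>c\<close> becomes zero.\<close>

definition pivot_row :: "('e \<Rightarrow> 'c \<Rightarrow> real) \<Rightarrow> 'e \<Rightarrow> 'c \<Rightarrow> 'e \<Rightarrow> 'c \<Rightarrow> real" where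
  "pivot_row r e c f = (\<lambda>x. r e c * r f x - r f c * r e x)"

text \<open>The elimination is invertible as the pivot is nonzero, so it preserves the span. All
  pivoted rows vanish at \<open>c\<close> while \<open>r e\<close> does not, so \<open>r e\<close>
  adds one dimension.\<close>

lemma dim_pivot:
  assumes "finite F" "e \<notin> F" "r e c \<noteq> 0"
  shows "real_fun.dim (r ` insert e F) = Suc (real_fun.dim (pivot_row r e c ` F))"
proof -
  let ?r = "pivot_row r e c"
  have pivot: "?r f = (\<lambda>x. r e c * r f x) - (\<lambda>x. r f c * r e x)" for f
    by (auto simp: pivot_row_def fun_eq_iff)
  have row: "r f = (\<lambda>x. inverse (r e c) * ?r f x) + (\<lambda>x. (r f c / r e c) * r e x)" for f
    using assms(3) by (auto simp: pivot_row_def fun_eq_iff field_simps)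
  have "?r f \<in> real_fun.span (r ` insert e F)" if "f \<in> F" for f
    unfolding pivot
    by (intro real_fun.span_diff real_fun.span_scale real_fun.span_base) (use that in auto)
  moreover have "r f \<in> real_fun.span (insert (r e) (?r ` F))" if "f \<in> F" for f
    by (subst row, intro real_fun.span_add real_fun.span_scale real_fun.span_base) (use that in auto)
  ultimately have "real_fun.span (r ` insert e F) = real_fun.span (insert (r e) (?r ` F))"
    unfolding real_fun.span_eq by (auto intro: real_fun.span_base)
  then have "real_fun.dim (r ` insert e F) = real_fun.dim (insert (r e) (?r ` F))"
    by (metis real_fun.dim_span)
  moreover have "r e \<notin> real_fun.span (?r ` F)"
  proof
    assume "r e \<in> real_fun.span (?r ` F)"
    then have "r e c = 0" by (rule in_span_eq_zero) (auto simp: pivot_row_def)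
    with assms(3) show False ..
  qed
  ultimately show ?thesis
    using assms(1) by (simp add: real_fun.dim_insert_finite)
qed

text \<open>
  \<open>S\<close> plays the role of the pairs \<open>(f x, f y)\<close> of values of a rational polynomial \<open>f\<close> at two
  generic points: such values vanish simultaneously, so fraction-free Gaussian elimination
  takes the same course at both points.
\<close>

lemma dim_eq_of_paired_entries:
  fixes r s :: "'e \<Rightarrow> 'c \<Rightarrow> real"
  assumes S_zero: "\<And>a b. (a, b) \<in> S \<Longrightarrow> a = 0 \<longleftrightarrow> b = 0"
    and S_mult: "\<And>a b c d. (a, b) \<in> S \<Longrightarrow> (c, d) \<in> S \<Longrightarrow> (a * c, b * d) \<in> S"
    and S_diff: "\<And>a b c d. (a, b) \<in> S \<Longrightarrow> (c, d) \<in> S \<Longrightarrow> (a - c, b - d) \<in> S"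
    and "finite F" "\<And>e c. e \<in> F \<Longrightarrow> (r e c, s e c) \<in> S"
  shows "real_fun.dim (r ` F) = real_fun.dim (s ` F)"
  using assms(4,5)
proof (induction "card F" arbitrary: F r s)
  case 0
  then show ?case by simp
next
  case (Suc n)
  show ?case
  proof (cases "\<exists>e\<in>F. \<exists>c. r e c \<noteq> 0")
    case False
    then have "r e = (\<lambda>_. 0)" "s e = (\<lambda>_. 0)" if "e \<in> F" for e
      using Suc.prems(2)[OF that, THEN S_zero] that by (auto simp: fun_eq_iff)
    then have "r ` F = s ` F" by auto
    then show ?thesis by simp
  next
    case True
    \<comment> \<open>Paired entries vanish together, so the same position serves as pivot in both
      matrices.\<close>
    then obtain e c where e: "e \<in> F" "r e c \<noteq> 0" "s e c \<noteq> 0"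
      using Suc.prems(2) S_zero by blast
    let ?F = "F - {e}"
    have "real_fun.dim (pivot_row r e c ` ?F) = real_fun.dim (pivot_row s e c ` ?F)"
    proof (rule Suc.hyps(1))
      show "n = card ?F" "finite ?F"
        using Suc.hyps(2) Suc.prems(1) e(1) by auto
      show "(pivot_row r e c f x, pivot_row s e c f x) \<in> S" if "f \<in> ?F" for f x
        unfolding pivot_row_def using that e(1) by (intro S_diff S_mult Suc.prems(2)) auto
    qed
    then show ?thesis
      using dim_pivot[of ?F e r c] dim_pivot[of ?F e s c] e Suc.prems(1) by (simp add: insert_absorb)
  qed
qed

section \<open>Rigidity matrices at generic placements\<close>

lemma rigidity_row_edge:
  "rigidity_row k p {x, y} (y, i) = (if i < k then p y i - p x i else 0)"
  by (cases "x = y") (auto simp: rigidity_row_def insert_Diff_if)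

lemma rigidity_row_notin: "z \<notin> e \<or> \<not> i < k \<Longrightarrow> rigidity_row k p e (z, i) = 0"
  by (auto simp: rigidity_row_def)

text \<open>Each entry is the value of one rational polynomial at \<open>p\<close> and at
  \<open>q\<close>; at a generic point only the zero polynomial vanishes, so paired values vanish
  together.\<close>

lemma rigidity_matrix_rank_generic:
  fixes V :: "'v set"
  assumes "finite F" "\<And>e. e \<in> F \<Longrightarrow> \<exists>x\<in>V. \<exists>y\<in>V. e = {x, y}"
    and "generic k V p" "generic k V q"
  shows "rigidity_matrix_rank k F p = rigidity_matrix_rank k F q"
proof -
  define I where "I = V \<times> {..<k}"
  define S where "S = {(poly_value P (\<lambda>(x, i). p x i), poly_value P (\<lambda>(x, i). q x i)) | P. poly_in I P}"
  have S_diff: "(a - c, b - d) \<in> S" if "(a, b) \<in> S" "(c, d) \<in> S" for a b c d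
    using that unfolding S_def by (auto simp flip: poly_value_diff intro: poly_in_diff)
  have S_zero: "(0, 0) \<in> S"
    unfolding S_def by (auto simp: poly_in_def intro!: exI[of _ 0])
  have S_coord: "(p x i, q x i) \<in> S" if "x \<in> V" "i < k" for x i
  proof -
    let ?P = "Poly_Mapping.single (Poly_Mapping.single (x, i) 1) 1 :: _ \<Rightarrow>\<^sub>0 rat"
    have "poly_in I ?P" using that by (simp add: poly_in_def I_def)
    moreover have "poly_value ?P f = f (x, i)" for f
      by (simp add: poly_value_single monom_value_def)
    ultimately show ?thesis
      unfolding S_def mem_Collect_eq by (intro exI[of _ ?P]) simp
  qed
  show ?thesis
    unfolding rigidity_matrix_rank_def
  proof (rule dim_eq_of_paired_entries[where S = S])
    fix e :: "'v set" and c :: "'v \<times> nat"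
    assume "e \<in> F"
    then obtain x y where e: "x \<in> V" "y \<in> V" "e = {x, y}" using assms(2) by blast
    obtain z i where c: "c = (z, i)" by fastforce
    \<comment> \<open>The third case swaps the endpoints, since \<open>rigidity_row_edge\<close>
      describes the column of the second one.\<close>
    consider "z \<notin> e \<or> \<not> i < k" | "i < k" "z = y" | "i < k" "z = x" "e = {y, x}"
      using e(3) by auto
    then show "(rigidity_row k p e c, rigidity_row k q e c) \<in> S"
    proof cases
      case 1
      then show ?thesis using S_zero by (simp add: c rigidity_row_notin)
    next
      case 2
      then show ?thesis using S_diff S_coord e by (simp add: c rigidity_row_edge)
    next
      case 3
      then show ?thesis using S_diff S_coord e(1,2) by (simp only: c rigidity_row_edge) simp
    qed
  next
    show "a = 0 \<longleftrightarrow> b = 0" if "(a, b) \<in> S" for a b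
      using that assms(3,4) unfolding S_def generic_def alg_independent_rat_iff I_def by auto
    show "(a * c, b * d) \<in> S" if "(a, b) \<in> S" "(c, d) \<in> S" for a b c d
      using that unfolding S_def by (auto simp flip: poly_value_mult intro: poly_in_mult)
  qed (use S_diff assms(1) in auto)
qed

text \<open>The description by \<open>THE\<close> is well defined: \<open>p\<close> witnesses the
  value, and all generic placements agree on it.\<close>

lemma rigidity_rank_eq:
  assumes "finite F" "\<And>e. e \<in> F \<Longrightarrow> \<exists>x\<in>V. \<exists>y\<in>V. e = {x, y}" "generic k V p"
  shows "rigidity_rank k V F = rigidity_matrix_rank k F p"
  unfolding rigidity_rank_def
  using rigidity_matrix_rank_generic[OF assms(1,2)] assms(3) by (intro the_equality) blast+

text \<open>One generic placement decides linkedness, since a new row keeps the rank exactly when it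
  lies in the span of the old rows.\<close>

lemma linked_iff_span:
  assumes "finite E" "\<And>e. e \<in> E \<Longrightarrow> \<exists>x\<in>V. \<exists>y\<in>V. e = {x, y}" "u \<in> V" "v \<in> V" "generic k V p"
  shows "linked k V E u v \<longleftrightarrow> rigidity_row k p {u, v} \<in> real_fun.span (rigidity_row k p ` E)"
proof -
  have "rigidity_rank k V (add_edge u v E) = rigidity_matrix_rank k (add_edge u v E) p"
    using assms by (intro rigidity_rank_eq) (auto simp: add_edge_def)
  moreover have "rigidity_rank k V E = rigidity_matrix_rank k E p"
    using assms(1,2,5) by (rule rigidity_rank_eq)
  ultimately show ?thesis
    using assms(1) by (simp add: linked_def rigidity_matrix_rank_def add_edge_def
        real_fun.dim_insert_finite)
qed

section \<open>Existence and lifts of generic placements\<close>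

lemma generic_subset: "generic k V p \<Longrightarrow> d \<le> k \<Longrightarrow> generic d V p"
  unfolding generic_def by (rule alg_independent_rat_subset) auto

lemma generic_exists:
  assumes "finite V"
  shows "\<exists>p. generic k V p"
proof -
  obtain y where "alg_independent_rat ({} \<union> V \<times> {..<k}) y"
    using alg_independent_rat_extend[OF _ _ alg_independent_rat_empty] assms
    by (metis finite.emptyI finite_SigmaI finite_lessThan)
  then have "generic k V (\<lambda>x i. y (x, i))" by (simp add: generic_def)
  then show ?thesis by blast
qed

text \<open>Everything except the new coordinate of \<open>w\<close> is made independent first. That
  last value is then chosen twice, the second time avoiding the first.\<close>

lemma generic_lifts:
  assumes "finite V" "generic d V p" "w \<in> V"
  obtains g a where "a \<noteq> g w"
    "generic (Suc d) V (\<lambda>x. (p x)(d := g x))"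
    "generic (Suc d) V (\<lambda>x. (p x)(d := (g(w := a)) x))"
proof -
  define I where "I = V \<times> {..<d} \<union> (V - {w}) \<times> {d}"
  have split: "insert (w, d) I = V \<times> {..<Suc d}" "(w, d) \<notin> I" "finite I"
    using assms(1,3) by (auto simp: I_def less_Suc_eq)
  have "\<exists>y. (\<forall>c\<in>V \<times> {..<d}. y c = (\<lambda>(x, i). p x i) c) \<and> alg_independent_rat I y"
    unfolding I_def by (rule alg_independent_rat_extend) (use assms in \<open>auto simp: generic_def\<close>)
  then obtain y where y: "\<forall>c\<in>V \<times> {..<d}. y c = (\<lambda>(x, i). p x i) c" "alg_independent_rat I y"
    by blast
  define g where "g x = y (x, d)" for x
  have lift: "generic (Suc d) V (\<lambda>x. (p x)(d := (g(w := b)) x))"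
    if "alg_independent_rat (insert (w, d) I) (y((w, d) := b))" for b
    unfolding generic_def split(1)[symmetric]
    using that y(1) split(1)
    by (subst alg_independent_rat_cong[where y = "y((w, d) := b)"])
      (auto simp: g_def less_Suc_eq I_def split: if_splits)
  obtain b where b: "alg_independent_rat (insert (w, d) I) (y((w, d) := b))"
    using alg_independent_rat_extend_notin[OF y(2) split(2,3), of "{}"] by auto
  obtain a where a: "a \<notin> {b}" "alg_independent_rat (insert (w, d) I) (y((w, d) := a))"
    using alg_independent_rat_extend_notin[OF y(2) split(2,3), of "{b}"] by auto
  show ?thesis
    \<comment> \<open>Updating \<open>g(w := b)\<close> again at \<open>w\<close> gives
      \<open>g(w := a)\<close>, so both choices are lifts of the required form.\<close>
    by (rule that[of a "g(w := b)"]) (use a(1) lift[OF b] lift[OF a(2)] in simp_all)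
qed

subsection \<open>Stresses\<close>

text \<open>Turns row dependencies into stress equations. The sign arises because the column of
  \<open>y\<close> holds \<open>p y i - p x i\<close>.\<close>

lemma sum_rigidity_rows:
  assumes "finite V" "finite F" "\<And>e. e \<in> F \<Longrightarrow> \<exists>x\<in>V. \<exists>y\<in>V. e = {x, y}" "y \<in> V" "i < k"
  shows "(\<Sum>e\<in>F. \<omega> e * rigidity_row k p e (y, i)) =
    - (\<Sum>x | x \<in> V \<and> {x, y} \<in> F. \<omega> {x, y} * (p x i - p y i))"
proof -
  have "(\<Sum>e\<in>F. \<omega> e * rigidity_row k p e (y, i)) =
      (\<Sum>e\<in>{e\<in>F. y \<in> e}. \<omega> e * rigidity_row k p e (y, i))"
    using assms(2) by (intro sum.mono_neutral_right) (auto simp: rigidity_row_notin)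
  also have "{e\<in>F. y \<in> e} = (\<lambda>x. {x, y}) ` {x. x \<in> V \<and> {x, y} \<in> F}"
    using assms(3) by (fastforce simp: insert_commute)
  also have "(\<Sum>e\<in>\<dots>. \<omega> e * rigidity_row k p e (y, i)) =
      (\<Sum>x | x \<in> V \<and> {x, y} \<in> F. \<omega> {x, y} * (p y i - p x i))"
    using assms(5)
    by (subst sum.reindex) (auto simp: rigidity_row_edge inj_on_def doubleton_eq_iff)
  finally show ?thesis
    by (simp add: sum_negf[symmetric] right_diff_distrib)
qed

text \<open>Up to sign the weighted graph Laplacian of \<open>\<omega>\<close>. Taking a scalar
  function \<open>h\<close> separates the stress condition into single coordinates.\<close>

definition laplacian :: "'v set \<Rightarrow> 'v set set \<Rightarrow> ('v set \<Rightarrow> real) \<Rightarrow> ('v \<Rightarrow> real) \<Rightarrow> 'v \<Rightarrow> real" where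
  "laplacian V F \<omega> h y = (\<Sum>x | x \<in> V \<and> {x, y} \<in> F. \<omega> {x, y} * (h x - h y))"

lemma stress_space_iff:
  "\<omega> \<in> stress_space k V F p \<longleftrightarrow>
     (\<forall>e. e \<notin> F \<longrightarrow> \<omega> e = 0) \<and> (\<forall>y\<in>V. \<forall>i<k. laplacian V F \<omega> (\<lambda>x. p x i) y = 0)"
  by (simp add: stress_space_def laplacian_def)

lemma laplacian_eq_if:
  assumes "finite V"
  shows "laplacian V F \<omega> h y = (\<Sum>x\<in>V. if {x, y} \<in> F then \<omega> {x, y} * (h x - h y) else 0)"
  unfolding laplacian_def using assms by (simp add: sum.inter_filter)

text \<open>Weights live on unordered pairs, so swapping the sums exchanges \<open>g\<close> and
  \<open>h\<close> in the mixed term; the diagonal term is symmetric already.\<close>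

lemma laplacian_symmetric:
  assumes "finite V"
  shows "(\<Sum>y\<in>V. g y * laplacian V F \<omega> h y) = (\<Sum>y\<in>V. h y * laplacian V F \<omega> g y)"
proof -
  define w where "w x y = (if {x, y} \<in> F then \<omega> {x, y} else 0)" for x y
  have L: "laplacian V F \<omega> h y = (\<Sum>x\<in>V. w x y * (h x - h y))" for h y
    unfolding laplacian_eq_if[OF assms] by (intro sum.cong) (auto simp: w_def)
  have sym: "w x y = w y x" for x y
    by (simp add: w_def insert_commute)
  have expand: "(\<Sum>y\<in>V. g y * laplacian V F \<omega> h y) =
      (\<Sum>y\<in>V. \<Sum>x\<in>V. w x y * (g y * h x)) - (\<Sum>y\<in>V. \<Sum>x\<in>V. w x y * (g y * h y))" for g h
    by (simp add: L sum_distrib_left algebra_simps sum_subtractf)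
  have "(\<Sum>y\<in>V. \<Sum>x\<in>V. w x y * (g y * h x)) = (\<Sum>x\<in>V. \<Sum>y\<in>V. w x y * (g y * h x))"
    by (rule sum.swap)
  also have "\<dots> = (\<Sum>y\<in>V. \<Sum>x\<in>V. w x y * (h y * g x))"
    by (simp add: sym mult.commute)
  finally show ?thesis
    unfolding expand by (simp add: mult.commute mult.left_commute)
qed

lemma laplacian_add_scale:
  "laplacian V F (\<lambda>e. \<omega> e + c * \<omega>' e) h y = laplacian V F \<omega> h y + c * laplacian V F \<omega>' h y"
  unfolding laplacian_def sum_distrib_left sum.distrib[symmetric]
  by (intro sum.cong refl) (simp add: algebra_simps)

lemma laplacian_add_edge:
  assumes "finite V" "\<omega> {u, v} = 0"
  shows "laplacian V (add_edge u v E) \<omega> h y = laplacian V E \<omega> h y"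
  unfolding laplacian_eq_if[OF assms(1)] using assms(2)
  by (intro sum.cong) (auto simp: add_edge_def)

text \<open>Coefficients are indexed by \<open>F\<close> instead of by vectors because distinct
  indices may have the same row.\<close>

lemma span_image_coeffs:
  fixes r :: "'e \<Rightarrow> 'c \<Rightarrow> real"
  assumes "finite F" "f \<in> real_fun.span (r ` F)"
  obtains \<mu> where "\<And>c. f c = (\<Sum>e\<in>F. \<mu> e * r e c)"
proof -
  have "\<exists>\<mu>. \<forall>c. f c = (\<Sum>e\<in>F. \<mu> e * r e c)"
    using assms(2)
  proof (induction rule: real_fun.span_induct_alt)
    case base
    show ?case by (intro exI[of _ "\<lambda>_. 0"]) simp
  next
    case (step a g h)
    then obtain e \<mu> where e: "e \<in> F" "g = r e" and h: "\<forall>c. h c = (\<Sum>e\<in>F. \<mu> e * r e c)"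
      by auto
    have "(\<Sum>e'\<in>F. (\<mu> e' + (if e' = e then a else 0)) * r e' c) =
        (\<Sum>e\<in>F. \<mu> e * r e c) + a * r e c" for c
      using assms(1) e(1) by (simp add: distrib_right sum.distrib if_distrib[of "\<lambda>t. t * _"] cong: if_cong)
    then show ?case
      using e h by (intro exI[of _ "\<lambda>e'. \<mu> e' + (if e' = e then a else 0)"]) simp
  qed
  then show ?thesis using that by blast
qed

text \<open>Moving the row of \<open>{u, v}\<close> to the other side of its expansion over
  \<open>E\<close> gives a row dependency, that is, a stress; this is where \<open>-1\<close> comes
  from.\<close>

lemma linked_stress:
  assumes "finite V" "finite E" "\<And>e. e \<in> E \<Longrightarrow> \<exists>x\<in>V. \<exists>y\<in>V. e = {x, y}" "u \<in> V" "v \<in> V"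
    and "generic k V p" "linked k V E u v" "{u, v} \<notin> E"
  obtains \<omega> where "\<omega> \<in> stress_space k V (add_edge u v E) p" "\<omega> {u, v} = -1"
proof -
  obtain \<mu> where \<mu>: "\<And>c. rigidity_row k p {u, v} c = (\<Sum>e\<in>E. \<mu> e * rigidity_row k p e c)"
    using linked_iff_span[OF assms(2-6)] assms(7) span_image_coeffs[OF assms(2)] by metis
  define \<omega> where "\<omega> e = (if e = {u, v} then -1 else if e \<in> E then \<mu> e else 0)" for e
  have "laplacian V (add_edge u v E) \<omega> (\<lambda>x. p x i) y = 0" if "y \<in> V" "i < k" for y i
  proof -
    have "laplacian V (add_edge u v E) \<omega> (\<lambda>x. p x i) y =
        - (\<Sum>e\<in>add_edge u v E. \<omega> e * rigidity_row k p e (y, i))"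
      unfolding laplacian_def using assms that
      by (subst sum_rigidity_rows[of V]) (auto simp: add_edge_def)
    also have "(\<Sum>e\<in>add_edge u v E. \<omega> e * rigidity_row k p e (y, i)) =
        - rigidity_row k p {u, v} (y, i) + (\<Sum>e\<in>E. \<omega> e * rigidity_row k p e (y, i))"
      using assms(2,8) by (simp add: add_edge_def \<omega>_def)
    also have "(\<Sum>e\<in>E. \<omega> e * rigidity_row k p e (y, i)) = (\<Sum>e\<in>E. \<mu> e * rigidity_row k p e (y, i))"
      using assms(8) by (intro sum.cong) (auto simp: \<omega>_def)
    finally show ?thesis using \<mu> by simp
  qed
  then show ?thesis
    by (intro that[of \<omega>]) (auto simp: stress_space_iff \<omega>_def add_edge_def)
qed

text \<open>Forgetting the coordinates from \<open>d\<close> on is a linear map taking rows in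
  dimension \<open>k\<close> to rows in dimension \<open>d\<close>, so it preserves membership in
  spans. Genericity survives too.\<close>

lemma linked_mono:
  assumes "finite V" "finite E" "\<And>e. e \<in> E \<Longrightarrow> \<exists>x\<in>V. \<exists>y\<in>V. e = {x, y}" "u \<in> V" "v \<in> V"
    and "linked k V E u v" "d \<le> k"
  shows "linked d V E u v"
proof -
  obtain p where p: "generic k V p" using generic_exists[OF assms(1)] by blast
  define t :: "('a \<times> nat \<Rightarrow> real) \<Rightarrow> 'a \<times> nat \<Rightarrow> real"
    where "t f = (\<lambda>(z, i). if i < d then f (z, i) else 0)" for f
  have t: "t (rigidity_row k p e) = rigidity_row d p e" for e
    using assms(7) by (auto simp: t_def rigidity_row_def fun_eq_iff)
  have "t f \<in> real_fun.span (t ` B)" if "f \<in> real_fun.span B" for f B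
    using that
  proof (induction rule: real_fun.span_induct_alt)
    case base
    have "t 0 = 0" by (auto simp: t_def)
    then show ?case by (metis real_fun.span_zero)
  next
    case (step c x y)
    have "t ((\<lambda>z. c * x z) + y) = (\<lambda>z. c * t x z) + t y"
      by (auto simp: t_def fun_eq_iff)
    moreover have "(\<lambda>z. c * t x z) + t y \<in> real_fun.span (t ` B)"
      using step by (intro real_fun.span_add real_fun.span_scale) (auto intro: real_fun.span_base)
    ultimately show ?case by (simp only:)
  qed
  then have "rigidity_row k p {u, v} \<in> real_fun.span (rigidity_row k p ` E) \<Longrightarrow>
      rigidity_row d p {u, v} \<in> real_fun.span (rigidity_row d p ` E)"
    by (metis (no_types, lifting) image_cong image_image t)
  then show ?thesis
    using linked_iff_span[OF assms(2-5) p] assms(6)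
      linked_iff_span[OF assms(2-5) generic_subset[OF p assms(7)]] by blast
qed

section \<open>Stress-linkedness from generic lifts\<close>

theorem theorem3p6:
  fixes d :: nat and V :: "'v set" and E :: "'v set set" and u v :: 'v
  assumes "d > 0"
    and "simple_graph V E"
    and "u \<in> V" and "v \<in> V"
    and "linked (d + 1) V E u v"
  shows "stress_linked d V E u v"
proof -
  have V: "finite V" and edges: "\<And>e. e \<in> E \<Longrightarrow> \<exists>x\<in>V. \<exists>y\<in>V. e = {x, y}"
    using assms(2) unfolding simple_graph_def by blast+
  have "E \<subseteq> Pow V" using edges by fastforce
  then have E: "finite E" using V by (meson finite_Pow_iff finite_subset)
  let ?E = "add_edge u v E"
  note graph = V E edges assms(3,4)
  have "stress_space d V ?E p \<subseteq> stress_space d V ?E q"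
    if p: "generic d V p" and sub: "stress_space d V E p \<subseteq> stress_space d V E q" for p q
  proof (cases "{u, v} \<in> E")
    case True
    then show ?thesis using sub by (simp add: add_edge_def insert_absorb)
  next
    \<comment> \<open>The degenerate case \<open>u = v\<close> belongs here, as \<open>E\<close> has
      no loops.\<close>
    case False
    show ?thesis
    proof
      fix \<omega> assume \<omega>: "\<omega> \<in> stress_space d V ?E p"
      have orth: "(\<Sum>y\<in>V. g y * laplacian V ?E \<omega> (\<lambda>x. q x i) y) = 0"
        if g: "generic (Suc d) V (\<lambda>x. (p x)(d := g x))" and i: "i < d" for g i
      proof -
        define h where "h x = q x i" for x
        obtain \<omega>' where \<omega>': "\<omega>' \<in> stress_space (Suc d) V ?E (\<lambda>x. (p x)(d := g x))" "\<omega>' {u, v} = -1"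
          using linked_stress[OF graph g _ False] assms(5) by auto
        \<comment> \<open>The multiple of \<open>\<omega>'\<close> cancels the weight of
          \<open>{u, v}\<close>, so \<open>\<sigma>\<close> is supported on
          \<open>E\<close>.\<close>
        define \<sigma> where "\<sigma> e = \<omega> e + \<omega> {u, v} * \<omega>' e" for e
        have uv: "\<sigma> {u, v} = 0" by (simp add: \<sigma>_def \<omega>'(2))
        have L\<sigma>: "laplacian V E \<sigma> f y =
            laplacian V ?E \<omega> f y + \<omega> {u, v} * laplacian V ?E \<omega>' f y" for f y
        proof -
          have "laplacian V E \<sigma> f y = laplacian V ?E \<sigma> f y"
            using V uv by (rule laplacian_add_edge[symmetric])
          then show ?thesis by (simp only: \<sigma>_def[abs_def] laplacian_add_scale)
        qed
        \<comment> \<open>Coordinates below \<open>d\<close> of the lift are those of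
          \<open>p\<close>; coordinate \<open>d\<close> is \<open>g\<close>.\<close>
        have p': "laplacian V ?E \<omega>' (\<lambda>x. p x j) y = 0" if "y \<in> V" "j < d" for y j
          using \<omega>'(1) that unfolding stress_space_iff by (auto dest!: bspec[of _ _ y] spec[of _ j])
        have g': "laplacian V ?E \<omega>' g y = 0" if "y \<in> V" for y
          using \<omega>'(1) that unfolding stress_space_iff by (auto dest!: bspec[of _ _ y] spec[of _ d])
        have "\<sigma> \<in> stress_space d V E p"
          unfolding stress_space_iff
        proof (intro conjI allI impI ballI)
          show "\<sigma> e = 0" if "e \<notin> E" for e
          proof (cases "e = {u, v}")
            case True
            then show ?thesis using uv by simp
          next
            case False
            then show ?thesis
              using that \<omega> \<omega>'(1) by (auto simp: \<sigma>_def stress_space_iff add_edge_def)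
          qed
          show "laplacian V E \<sigma> (\<lambda>x. p x j) y = 0" if "y \<in> V" "j < d" for y j
            using \<omega> p' that unfolding L\<sigma> by (simp add: stress_space_iff)
        qed
        then have "\<sigma> \<in> stress_space d V E q" using sub by blast
        \<comment> \<open>The inclusion of stress spaces makes the Laplacian of
          \<open>\<sigma>\<close> annihilate \<open>h\<close>; solving for the part of
          \<open>\<omega>\<close> gives this identity.\<close>
        then have "laplacian V ?E \<omega> h y = - \<omega> {u, v} * laplacian V ?E \<omega>' h y" if "y \<in> V" for y
          using that i unfolding stress_space_iff L\<sigma> h_def by (auto simp: eq_neg_iff_add_eq_0)
        then have "(\<Sum>y\<in>V. g y * laplacian V ?E \<omega> h y) =
            - \<omega> {u, v} * (\<Sum>y\<in>V. g y * laplacian V ?E \<omega>' h y)"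
          by (simp add: sum_distrib_left mult_ac flip: sum_negf)
        \<comment> \<open>Symmetry moves the Laplacian of \<open>\<omega>'\<close> from
          \<open>h\<close> to \<open>g\<close>, which it annihilates.\<close>
        also have "(\<Sum>y\<in>V. g y * laplacian V ?E \<omega>' h y) = 0"
          by (simp add: laplacian_symmetric[OF V, of g] g')
        finally show ?thesis by (simp add: h_def)
      qed
      have "laplacian V ?E \<omega> (\<lambda>x. q x i) w = 0" if w: "w \<in> V" and i: "i < d" for w i
      proof -
        let ?L = "laplacian V ?E \<omega> (\<lambda>x. q x i)"
        obtain g a where ga: "a \<noteq> g w" "generic (Suc d) V (\<lambda>x. (p x)(d := g x))"
          "generic (Suc d) V (\<lambda>x. (p x)(d := (g(w := a)) x))"
          by (rule generic_lifts[OF V p w])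
        \<comment> \<open>Neither \<open>\<omega>\<close> nor \<open>q\<close> depends on the lift,
          so the same Laplacian values are paired with both lifts, whose difference is supported at
          \<open>w\<close>.\<close>
        have "0 = (\<Sum>y\<in>V. (g(w := a)) y * ?L y) - (\<Sum>y\<in>V. g y * ?L y)"
          using orth[OF ga(2) i] orth[OF ga(3) i] by simp
        also have "\<dots> = (\<Sum>y\<in>V. if y = w then (a - g w) * ?L w else 0)"
          by (subst sum_subtractf[symmetric], intro sum.cong) (auto simp: left_diff_distrib)
        also have "\<dots> = (a - g w) * ?L w"
          using V w by simp
        finally show ?thesis using ga(1) by simp
      qed
      then show "\<omega> \<in> stress_space d V ?E q"
        using \<omega> unfolding stress_space_iff by simp
    qed
  qed
  moreover have "linked d V E u v"
    by (rule linked_mono[OF graph assms(5) le_add1])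
  ultimately show ?thesis unfolding stress_linked_def by blast
qed

end
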